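(* Let $n\ge2$, let $a_1,\dots,a_n\in[0,1]$, and let $T=(T_{ij})$ be the $n\times n$ matrix with $T_{ii}=a_i$ and $T_{ij}=\frac{1-a_i}{n-1}$ for $i\neq j$. Let $B=\frac{n-1}{n}(I-T)$, let $x_i=1-a_i$, and let $p(x)=(x-x_1)\cdots(x-x_n)$. Then the characteristic polynomial $p_B$ of $B$ satisfies $$p_B(x)=\frac{x}{n}\,\frac{dp(x)}{dx}.$$
   Context: The characteristic polynomial of an $n\times n$ matrix $A$ is $p_A(x)=\det(xI-A)$. *)

theory Defs
  imports "Jordan_Normal_Form.Char_Poly"
begin

(* The parameters a_1, ..., a_n are a 0, ..., a (n - 1), since matrix indices start at 0. *)

definition T_mat :: "nat \<Rightarrow> (nat \<Rightarrow> real) \<Rightarrow> real mat" where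
  "T_mat n a = mat n n (\<lambda>(i, j). if i = j then a i else (1 - a i) / (real n - 1))"

definition B_mat :: "nat \<Rightarrow> (nat \<Rightarrow> real) \<Rightarrow> real mat" where
  "B_mat n a = ((real n - 1) / real n) \<cdot>\<^sub>m (1\<^sub>m n - T_mat n a)"

definition x_val :: "(nat \<Rightarrow> real) \<Rightarrow> nat \<Rightarrow> real" where
  "x_val a i = 1 - a i"

definition p_poly :: "nat \<Rightarrow> (nat \<Rightarrow> real) \<Rightarrow> real poly" where
  "p_poly n a = (\<Prod>i<n. [:- x_val a i, 1:])"

end

theory Submission
  imports Defs
begin

text \<open>With \<open>x\<close> the column vector of the \<open>x\<^sub>i\<close>, the matrix \<open>t I - B\<close> is
  \<open>diag (t - x\<^sub>i) + x 1\<^sup>T / n\<close>, so its determinant is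
  \<open>p(t) + (1/n) \<Sum>\<^sub>i x\<^sub>i \<Prod>\<^sub>j\<^sub>\<noteq>\<^sub>i (t - x\<^sub>j)\<close>. Writing \<open>p(t) = (1/n) \<Sum>\<^sub>i (t - x\<^sub>i) \<Prod>\<^sub>j\<^sub>\<noteq>\<^sub>i (t - x\<^sub>j)\<close>,
  the two sums combine to \<open>(t/n) p'(t)\<close>.\<close>

text \<open>The last diagonal summand is missing, so the last column is just \<open>u\<close>.
  Subtracting it from every other column cancels the constant rows and leaves an upper triangular
  matrix with diagonal entries \<open>d i\<close> for \<open>i < n\<close>, followed by
  \<open>u n\<close>.\<close>

lemma det_diag_column_bordered:
  fixes d u :: "nat \<Rightarrow> 'a :: comm_ring_1"
  shows "det (mat (Suc n) (Suc n) (\<lambda>(i, j). (if i = j \<and> j < n then d i else 0) + u i))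
    = u n * (\<Prod>i<n. d i)"
proof -
  define N where "N = mat (Suc n) (Suc n) (\<lambda>(i, j). if j = n then u i else if i = j then d i else 0)"
  \<comment> \<open>Right multiplication by \<open>L\<close> adds the last column to all the others,
    so \<open>N\<close> is the matrix after that column operation has been undone.\<close>
  define L :: "'a mat"
    where "L = mat (Suc n) (Suc n) (\<lambda>(i, j). if i = n \<or> i = j then 1 else 0)"
  have carr: "N \<in> carrier_mat (Suc n) (Suc n)" "L \<in> carrier_mat (Suc n) (Suc n)"
    by (auto simp: N_def L_def)
  have "mat (Suc n) (Suc n) (\<lambda>(i, j). (if i = j \<and> j < n then d i else 0) + u i) = N * L"
  proof (rule eq_matI)
    fix i j assume "i < dim_row (N * L)" "j < dim_col (N * L)"
    then have ij: "i < Suc n" "j < Suc n" by (auto simp: N_def L_def)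
    have "(N * L) $$ (i, j) = (\<Sum>k<Suc n. N $$ (i, k) * L $$ (k, j))"
      using ij carr by (simp add: scalar_prod_def atLeast0LessThan)
    also have "\<dots> = (\<Sum>k<n. N $$ (i, k) * L $$ (k, j)) + u i"
      using ij by (simp add: N_def L_def)
    also have "(\<Sum>k<n. N $$ (i, k) * L $$ (k, j)) = (\<Sum>k<n. if k = j then (if i = j then d i else 0) else 0)"
      using ij by (intro sum.cong) (auto simp: N_def L_def)
    also have "\<dots> = (if i = j \<and> j < n then d i else 0)"
      by (simp add: sum.delta)
    finally show "mat (Suc n) (Suc n) (\<lambda>(i, j). (if i = j \<and> j < n then d i else 0) + u i) $$ (i, j)
        = (N * L) $$ (i, j)"
      using ij by simp
  qed (auto simp: N_def L_def)
  moreover have "det N = u n * (\<Prod>i<n. d i)"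
  proof -
    have "det N = prod_list (diag_mat N)"
      using carr by (intro det_upper_triangular) (auto simp: N_def)
    also have "\<dots> = u n * (\<Prod>i<n. d i)"
      by (simp add: prod_list_diag_prod N_def atLeast0LessThan mult.commute)
    finally show ?thesis .
  qed
  moreover have "det L = 1"
  proof -
    have "det L = prod_list (diag_mat L)"
      by (rule det_lower_triangular[OF _ carr(2)]) (auto simp: L_def)
    also have "\<dots> = 1"
      by (simp add: prod_list_diag_prod L_def)
    finally show ?thesis .
  qed
  ultimately show ?thesis
    using det_mult[OF carr] by simp
qed

text \<open>A division-free form of the matrix determinant lemma: the entries \<open>d i\<close>
  will be the non-unit polynomials x - x_i, so the diagonal part cannot be inverted. Induction works
  instead, since the determinant is affine in the corner entry: its slope is the determinant of size
  \<open>n\<close>, and the preceding lemma gives the value when \<open>d n\<close> is dropped from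
  the corner.\<close>

lemma det_diag_plus_const_rows:
  fixes d u :: "nat \<Rightarrow> 'a :: comm_ring_1"
  shows "det (mat n n (\<lambda>(i, j). (if i = j then d i else 0) + u i))
    = (\<Prod>i<n. d i) + (\<Sum>i<n. u i * (\<Prod>j\<in>{..<n} - {i}. d j))"
proof (induction n)
  case 0
  show ?case by (simp add: det_def)
next
  case (Suc n)
  define M where "M = (\<lambda>n. mat n n (\<lambda>(i, j). (if i = j then d i else 0) + u i))"
  define M' where "M' = mat (Suc n) (Suc n) (\<lambda>(i, j). (if i = j \<and> j < n then d i else 0) + u i)"
  have carr: "M (Suc n) \<in> carrier_mat (Suc n) (Suc n)" "M' \<in> carrier_mat (Suc n) (Suc n)"
    by (auto simp: M_def M'_def)
  \<comment> \<open>\<open>M'\<close> differs from \<open>M (Suc n)\<close> only in the corner entry, hence has the same cofactors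
    along the last column.\<close>
  have "mat_delete (M (Suc n)) i n = mat_delete M' i n" for i
    by (rule eq_matI) (auto simp: mat_delete_def M_def M'_def)
  then have cof: "cofactor (M (Suc n)) i n = cofactor M' i n" for i
    by (simp add: cofactor_def)
  have "mat_delete M' n n = M n"
    by (rule eq_matI) (auto simp: mat_delete_def M_def M'_def)
  then have corner: "cofactor M' n n = det (M n)"
    by (simp add: cofactor_def)
  have "det (M (Suc n)) = (\<Sum>i<Suc n. M (Suc n) $$ (i, n) * cofactor M' i n)"
    using laplace_expansion_column[OF carr(1), of n] by (simp add: cof)
  also have "\<dots> = (\<Sum>i<Suc n. M' $$ (i, n) * cofactor M' i n) + d n * det (M n)"
  proof -
    have "M (Suc n) $$ (i, n) = M' $$ (i, n)" if "i < n" for i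
      using that by (simp add: M_def M'_def)
    moreover have "M (Suc n) $$ (n, n) = M' $$ (n, n) + d n"
      by (simp add: M_def M'_def)
    ultimately show ?thesis
      by (simp add: corner distrib_right add.assoc)
  qed
  also have "\<dots> = det M' + d n * det (M n)"
    using laplace_expansion_column[OF carr(2), of n] by simp
  also have "det M' = u n * (\<Prod>i<n. d i)"
    unfolding M'_def by (rule det_diag_column_bordered)
  also have "det (M n) = (\<Prod>i<n. d i) + (\<Sum>i<n. u i * (\<Prod>j\<in>{..<n} - {i}. d j))"
    unfolding M_def by (rule Suc.IH)
  also have "u n * (\<Prod>i<n. d i) + d n * \<dots>
      = (\<Prod>i<Suc n. d i) + (\<Sum>i<Suc n. u i * (\<Prod>j\<in>{..<Suc n} - {i}. d j))"
  proof -
    \<comment> \<open>Each old summand gains the factor \<open>d n\<close>, while the new summand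
      for index \<open>n\<close> is exactly the determinant of \<open>M'\<close>.\<close>
    have "{..<Suc n} - {i} = insert n ({..<n} - {i})" if "i < n" for i
      using that by auto
    then have "(\<Sum>i<n. u i * (\<Prod>j\<in>{..<Suc n} - {i}. d j))
        = (\<Sum>i<n. d n * (u i * (\<Prod>j\<in>{..<n} - {i}. d j)))"
      by (intro sum.cong) (auto simp: algebra_simps)
    moreover have "{..<Suc n} - {n} = {..<n}"
      by auto
    ultimately show ?thesis
      by (simp add: sum_distrib_left algebra_simps)
  qed
  finally show ?case by (simp add: M_def)
qed

theorem lemmaB:
  fixes n :: nat and a :: "nat \<Rightarrow> real"
  assumes "n \<ge> 2"
    and "\<forall>i<n. a i \<in> {0..1}"
  shows "char_poly (B_mat n a) = Polynomial.smult (1 / real n) ([:0, 1:] * pderiv (p_poly n a))"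
proof -
  define d where "d = (\<lambda>i. [:- x_val a i, 1:])"
  define Q where "Q = (\<lambda>i. \<Prod>j\<in>{..<n} - {i}. d j)"
  have n: "real n \<noteq> 0" "real n - 1 \<noteq> 0"
    using assms(1) by auto
  have "char_poly_matrix (B_mat n a)
      = mat n n (\<lambda>(i, j). (if i = j then d i else 0) + [:x_val a i / real n:])"
  proof (rule eq_matI)
    \<comment> \<open>These two identities give the entries of B: -x_i/n off the diagonal and x_i -
      x_i/n on it. Hence x_i/n occurs along the whole of row i of xI - B.\<close>
    have "(real n - 1) / real n * ((1 - a i) / (real n - 1)) = (1 - a i) / real n" for i
      using n by simp
    moreover have "(real n - 1) / real n * (1 - a i) = (1 - a i) - (1 - a i) / real n" for i
      using n by (simp add: field_simps)
    moreover fix i j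
    assume "i < dim_row (mat n n (\<lambda>(i, j). (if i = j then d i else 0) + [:x_val a i / real n:]))"
      "j < dim_col (mat n n (\<lambda>(i, j). (if i = j then d i else 0) + [:x_val a i / real n:]))"
    ultimately show "char_poly_matrix (B_mat n a) $$ (i, j)
        = mat n n (\<lambda>(i, j). (if i = j then d i else 0) + [:x_val a i / real n:]) $$ (i, j)"
      \<comment> \<open>The deleted rules would regroup the fractions; without them the left-hand
        sides of the two identities keep the shape that the entries have.\<close>
      by (simp add: char_poly_matrix_def B_mat_def T_mat_def d_def x_val_def
          del: times_divide_eq_left times_divide_eq_right times_divide_times_eq)
  qed (auto simp: char_poly_matrix_def B_mat_def T_mat_def)
  then have "char_poly (B_mat n a) = (\<Prod>i<n. d i) + (\<Sum>i<n. [:x_val a i / real n:] * Q i)"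
    by (simp only: char_poly_def det_diag_plus_const_rows Q_def)
  also have "(\<Prod>i<n. d i) = (\<Sum>i<n. Polynomial.smult (1 / real n) (d i * Q i))"
  proof -
    have "(\<Prod>i<n. d i) = d i * Q i" if "i < n" for i
      using that by (simp add: Q_def prod.remove)
    then have "(\<Sum>i<n. Polynomial.smult (1 / real n) (d i * Q i))
        = (\<Sum>i<n. Polynomial.smult (1 / real n) (\<Prod>i<n. d i))"
      by (intro sum.cong) auto
    \<comment> \<open>The n equal summands contribute the factor n as a constant polynomial, which
      cancels 1/n.\<close>
    then show ?thesis
      using n by (simp add: of_nat_poly)
  qed
  also have "\<dots> + (\<Sum>i<n. [:x_val a i / real n:] * Q i)
      = (\<Sum>i<n. Polynomial.smult (1 / real n) ([:0, 1:] * Q i))"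
    unfolding sum.distrib[symmetric]
  proof (intro sum.cong refl)
    fix i
    have "[:0, 1:] = d i + [:x_val a i:]"
      by (simp add: d_def)
    then have "Polynomial.smult (1 / real n) ([:0, 1:] * Q i)
        = Polynomial.smult (1 / real n) ((d i + [:x_val a i:]) * Q i)"
      by (simp only:)
    then show "Polynomial.smult (1 / real n) (d i * Q i) + [:x_val a i / real n:] * Q i
        = Polynomial.smult (1 / real n) ([:0, 1:] * Q i)"
      by (simp only: distrib_right smult_add_right) simp
  qed
  also have "\<dots> = Polynomial.smult (1 / real n) ([:0, 1:] * (\<Sum>i<n. Q i))"
    by (simp only: smult_sum2 sum_distrib_left)
  \<comment> \<open>Product rule: every factor \<open>d i\<close> is monic linear and has derivative
    1, so only the product \<open>Q i\<close> of the other factors remains.\<close>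
  also have "(\<Sum>i<n. Q i) = pderiv (p_poly n a)"
    by (simp add: p_poly_def pderiv_prod Q_def d_def pderiv_pCons)
  finally show ?thesis .
qed

end
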